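(* Let $m$ be a $\sigma$-finite measure on a Lusin measurable space $(E,\mathcal{B})$, let $1<p<\infty$, and let $\mathcal{U}=(U_\alpha)_{\alpha>0}$ be a resolvent family of continuous linear operators on $L^p(E,m)$ such that $\|\alpha U_\alpha\|_p\le M$ for all $\alpha>0$ and for some positive constant $M<\infty$. Then $\mathcal{U}$ is ergodic, i.e. the strong limit $\lim_{\alpha\to0}\alpha U_\alpha u$ exists in $L^p(E,m)$ for every $u\in L^p(E,m)$. More precisely, for one (hence for all) $\beta>0$ and for all $u\in L^p(E,m)$ there exists $u'\in\mathrm{Ker}(\mathcal{I}-\beta U_\beta)$ such that $$\lim_{\alpha\to0}\|\alpha U_\alpha u-u'\|_p=0 .$$
   Context: A resolvent family is a family $(U_\alpha)_{\alpha>0}$ of operators satisfying the resolvent equation $U_\alpha-U_\beta=(\beta-\alpha)U_\alpha U_\beta$ for all $\alpha,\beta>0$ (no sub-Markov property, positivity, injectivity or strong continuity is assumed). $\mathcal{I}$ is the identity operator, and $\|\cdot\|_p$ denotes the $L^p(E,m)$-norm and the corresponding operator norm. *)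

theory Defs
  imports "HOL-Analysis.Analysis"
begin

text \<open>
  A Lusin measurable space is one that is measurably isomorphic to a Borel subset of a compact
  metrizable space. A compact metrizable space has at most continuum many points, so it is no
  restriction to let its points be drawn from the type \<^typ>\<open>real\<close>; the topology \<open>K\<close> is arbitrary
  and unrelated to the usual one. Only \<open>space M\<close> and \<open>sets M\<close> matter.
\<close>

definition borel_of :: "'b topology \<Rightarrow> 'b measure" where
  "borel_of K = sigma (topspace K) {V. openin K V}"

definition measurable_isomorphism :: "'a measure \<Rightarrow> 'b measure \<Rightarrow> ('a \<Rightarrow> 'b) \<Rightarrow> bool" where
  "measurable_isomorphism M N f \<longleftrightarrow>
     bij_betw f (space M) (space N) \<and> f \<in> measurable M N \<and> inv_into (space M) f \<in> measurable N M"

definition Lusin_measurable_space :: "'a measure \<Rightarrow> bool" where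
  "Lusin_measurable_space M \<longleftrightarrow>
     (\<exists>(K :: real topology) B f.
        compact_space K \<and> metrizable_space K \<and> B \<in> sets (borel_of K) \<and>
        measurable_isomorphism M (restrict_space (borel_of K) B) f)"

text \<open>
  Elements of $L^p$ are represented by functions, and equality in $L^p$ is equality almost
  everywhere. An operator on $L^p$ is a map on representatives that respects this equality;
  every operator on equivalence classes arises in this way by choosing representatives.
\<close>

definition Lp :: "real \<Rightarrow> 'a measure \<Rightarrow> ('a \<Rightarrow> real) set" where
  "Lp p M = {f \<in> borel_measurable M. integrable M (\<lambda>x. \<bar>f x\<bar> powr p)}"

definition Lp_norm :: "real \<Rightarrow> 'a measure \<Rightarrow> ('a \<Rightarrow> real) \<Rightarrow> real" where
  "Lp_norm p M f = (LINT x|M. \<bar>f x\<bar> powr p) powr (1 / p)"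

definition Lp_bounded_linear ::
    "real \<Rightarrow> 'a measure \<Rightarrow> (('a \<Rightarrow> real) \<Rightarrow> 'a \<Rightarrow> real) \<Rightarrow> bool" where
  "Lp_bounded_linear p M T \<longleftrightarrow>
     (\<forall>f\<in>Lp p M. T f \<in> Lp p M) \<and>
     (\<forall>f\<in>Lp p M. \<forall>g\<in>Lp p M. (AE x in M. f x = g x) \<longrightarrow> (AE x in M. T f x = T g x)) \<and>
     (\<forall>f\<in>Lp p M. \<forall>g\<in>Lp p M. AE x in M. T (\<lambda>y. f y + g y) x = T f x + T g x) \<and>
     (\<forall>c. \<forall>f\<in>Lp p M. AE x in M. T (\<lambda>y. c * f y) x = c * T f x) \<and>
     (\<exists>C. \<forall>f\<in>Lp p M. Lp_norm p M (T f) \<le> C * Lp_norm p M f)"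

text \<open>
  As for \<^const>\<open>onorm\<close>, the supremum is only meaningful for bounded operators; functions of
  norm zero contribute the value \<open>0\<close>.
\<close>

definition Lp_onorm :: "real \<Rightarrow> 'a measure \<Rightarrow> (('a \<Rightarrow> real) \<Rightarrow> 'a \<Rightarrow> real) \<Rightarrow> real" where
  "Lp_onorm p M T = (SUP f\<in>Lp p M. Lp_norm p M (T f) / Lp_norm p M f)"

definition Lp_kernel :: "real \<Rightarrow> 'a measure \<Rightarrow> (('a \<Rightarrow> real) \<Rightarrow> 'a \<Rightarrow> real) \<Rightarrow> ('a \<Rightarrow> real) set" where
  "Lp_kernel p M T = {f \<in> Lp p M. AE x in M. T f x = 0}"

text \<open>Only the operators \<open>U \<alpha>\<close> with \<open>\<alpha> > 0\<close> are constrained.\<close>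

definition Lp_resolvent_family ::
    "real \<Rightarrow> 'a measure \<Rightarrow> (real \<Rightarrow> ('a \<Rightarrow> real) \<Rightarrow> 'a \<Rightarrow> real) \<Rightarrow> bool" where
  "Lp_resolvent_family p M U \<longleftrightarrow>
     (\<forall>\<alpha>>0. Lp_bounded_linear p M (U \<alpha>)) \<and>
     (\<forall>\<alpha>>0. \<forall>\<beta>>0. \<forall>f\<in>Lp p M. AE x in M. U \<alpha> f x - U \<beta> f x = (\<beta> - \<alpha>) * U \<alpha> (U \<beta> f) x)"

definition Lp_ergodic ::
    "real \<Rightarrow> 'a measure \<Rightarrow> (real \<Rightarrow> ('a \<Rightarrow> real) \<Rightarrow> 'a \<Rightarrow> real) \<Rightarrow> bool" where
  "Lp_ergodic p M U \<longleftrightarrow>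
     (\<forall>u\<in>Lp p M. \<exists>u'\<in>Lp p M.
        ((\<lambda>\<alpha>. Lp_norm p M (\<lambda>x. \<alpha> * U \<alpha> u x - u' x)) \<longlongrightarrow> 0) (at_right 0))"

end

theory Submission imports Defs begin

text \<open>
  This is the mean ergodic theorem for resolvents, with uniform convexity of \<open>L\<^sup>p\<close> in place of
  weak compactness. Both \<open>(I - \<beta> U\<^sub>\<beta>) \<alpha> U\<^sub>\<alpha> u\<close> and \<open>\<alpha> U\<^sub>\<alpha> (I - \<beta> U\<^sub>\<beta>) w\<close> are of order \<open>\<alpha>\<close> as
  \<open>\<alpha> \<longrightarrow> 0\<close>, and \<open>u - \<alpha> U\<^sub>\<alpha> u\<close> lies in the range of \<open>I - \<beta> U\<^sub>\<beta>\<close>. Hence the convex sets of all \<open>v\<close> in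
  \<open>u + range (I - \<beta> U\<^sub>\<beta>)\<close> for which \<open>(I - \<beta> U\<^sub>\<beta>) v\<close> is small are nonempty, and they contain elements
  of bounded norm. By uniform convexity, almost norm-minimal elements of a decreasing sequence of
  such sets form a Cauchy sequence. Its limit \<open>u'\<close> lies in \<open>Ker (I - \<beta> U\<^sub>\<beta>)\<close>, so it is fixed by
  every \<open>\<alpha> U\<^sub>\<alpha>\<close>, and \<open>u - u'\<close> lies in the closure of the range of \<open>I - \<beta> U\<^sub>\<beta>\<close>, where
  \<open>\<alpha> U\<^sub>\<alpha> \<longrightarrow> 0\<close> strongly.

  All estimates are made for \<open>\<integral> \<bar>f\<bar>\<^sup>p\<close> instead of the norm: the crude bound
  \<open>\<bar>x + y\<bar>\<^sup>p \<le> 2\<^sup>p (\<bar>x\<bar>\<^sup>p + \<bar>y\<bar>\<^sup>p)\<close> replaces Minkowski's inequality, and uniform convexity becomes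
  the integral of a pointwise inequality.
\<close>

section \<open>Uniform convexity\<close>

definition Lp_modular :: "real \<Rightarrow> 'a measure \<Rightarrow> ('a \<Rightarrow> real) \<Rightarrow> real" where
  "Lp_modular p M f = (LINT x|M. \<bar>f x\<bar> powr p)"

text \<open>The mean value theorem on the two halves of the interval yields slopes at points
  \<open>w < z\<close>, and the derivative is strictly increasing because p > 1. The increment over
  the left half is therefore strictly smaller.\<close>

lemma powr_midpoint_less:
  fixes a b p :: real
  assumes "1 < p" "0 \<le> a" "a < b"
  shows "((a + b) / 2) powr p < (a powr p + b powr p) / 2"
proof -
  define c where "c = (a + b) / 2"
  have ac: "a < c" "c < b" using assms by (auto simp: c_def)
  have cont: "continuous_on S (\<lambda>x. x powr p)" if "S \<subseteq> {0..}" for S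
    using that assms by (intro continuous_on_powr' continuous_intros) auto
  have der: "((\<lambda>x. x powr p) has_real_derivative p * x powr (p - 1)) (at x)" if "0 < x" for x
    using that by (rule has_real_derivative_powr)
  have diff: "(\<lambda>x. x powr p) differentiable (at x)" if "0 < x" for x
    using der[OF that] by (auto simp: real_differentiable_def)
  \<comment> \<open>Here a may be 0, where \<open>der\<close> does not apply, so this half uses the
    form of the mean value theorem that asks for differentiability in the interior only.\<close>
  have "\<exists>z>a. z < c \<and> (c powr p - a powr p = (c - a) * (p * z powr (p - 1)))"
  proof -
    have "\<exists>l z. a < z \<and> z < c \<and> ((\<lambda>x. x powr p) has_real_derivative l) (at z) \<and> c powr p - a powr p = (c - a) * l"
      using ac assms diff by (intro MVT cont) auto
    then obtain l z where z: "a < z" "z < c" "((\<lambda>x. x powr p) has_real_derivative l) (at z)" 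
      "c powr p - a powr p = (c - a) * l" by blast
    moreover have "l = p * z powr (p - 1)" using DERIV_unique[OF z(3) der[of z]] z assms by auto
    ultimately show ?thesis by blast
  qed
  then obtain w where w: "a < w" "w < c" "c powr p - a powr p = (c - a) * (p * w powr (p - 1))" by blast
  obtain z where z: "c < z" "z < b" "b powr p - c powr p = (b - c) * (p * z powr (p - 1))"
    using MVT2[OF ac(2), of "\<lambda>x. x powr p" "\<lambda>x. p * x powr (p - 1)"] der ac assms by force
  have "w powr (p - 1) < z powr (p - 1)" using w z assms by (intro powr_less_mono2) auto
  then have "(c - a) * (p * w powr (p - 1)) < (c - a) * (p * z powr (p - 1))" 
    using ac assms by (intro mult_strict_left_mono) auto
  moreover have "b - c = c - a" by (simp add: c_def field_simps)
  ultimately have "c powr p - a powr p < b powr p - c powr p" using w(3) z(3) by simp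
  then show ?thesis by (simp add: c_def)
qed

text \<open>Distinct numbers of equal modulus are opposite, so their midpoint vanishes. Otherwise
  the triangle inequality reduces the claim to the strict inequality for the moduli.\<close>

lemma abs_powr_midpoint_less:
  fixes x y p :: real
  assumes "1 < p" "x \<noteq> y"
  shows "\<bar>(x + y) / 2\<bar> powr p < (\<bar>x\<bar> powr p + \<bar>y\<bar> powr p) / 2"
proof (cases "\<bar>x\<bar> = \<bar>y\<bar>")
  case True
  then have "y = - x" "x \<noteq> 0" using assms by (auto simp: abs_if split: if_splits)
  then show ?thesis using assms by auto
next
  case False
  have "\<bar>(x + y) / 2\<bar> powr p \<le> ((\<bar>x\<bar> + \<bar>y\<bar>) / 2) powr p"
    using assms by (intro powr_mono2) auto
  also have "\<dots> < (\<bar>x\<bar> powr p + \<bar>y\<bar> powr p) / 2"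
    using False powr_midpoint_less[OF assms(1), of "\<bar>x\<bar>" "\<bar>y\<bar>"]
      powr_midpoint_less[OF assms(1), of "\<bar>y\<bar>" "\<bar>x\<bar>"]
    by (cases "\<bar>x\<bar> < \<bar>y\<bar>") (auto simp: add.commute)
  finally show ?thesis .
qed

lemma abs_powr_midpoint_le:
  fixes x y p :: real
  assumes "1 < p"
  shows "\<bar>(x + y) / 2\<bar> powr p \<le> (\<bar>x\<bar> powr p + \<bar>y\<bar> powr p) / 2"
  using abs_powr_midpoint_less[OF assms, of x y] by (cases "x = y") auto

lemma abs_powr_add_le:
  fixes x y p :: real
  assumes "0 \<le> p"
  shows "\<bar>x + y\<bar> powr p \<le> 2 powr p * (\<bar>x\<bar> powr p + \<bar>y\<bar> powr p)"
proof -
  have "\<bar>x + y\<bar> powr p \<le> (2 * max \<bar>x\<bar> \<bar>y\<bar>) powr p" using assms by (intro powr_mono2) auto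
  also have "\<dots> = 2 powr p * max \<bar>x\<bar> \<bar>y\<bar> powr p" by (simp add: powr_mult)
  also have "\<dots> \<le> 2 powr p * (\<bar>x\<bar> powr p + \<bar>y\<bar> powr p)"
    by (intro mult_left_mono) (auto simp: max_def)
  finally show ?thesis .
qed

text \<open>By homogeneity the inequality reduces to \<open>x = 1\<close>, \<open>\<bar>y\<bar> \<le> 1\<close>, where strict convexity and
  compactness bound the convexity defect from below away from \<open>y = 1\<close>.\<close>

lemma abs_powr_uniform_convexity:
  fixes p \<epsilon> :: real
  assumes p: "1 < p" and \<epsilon>: "0 < \<epsilon>"
  obtains K where "0 \<le> K"
    "\<And>x y :: real. \<bar>x - y\<bar> powr p \<le>
       \<epsilon> * (\<bar>x\<bar> powr p + \<bar>y\<bar> powr p) + K * ((\<bar>x\<bar> powr p + \<bar>y\<bar> powr p) / 2 - \<bar>(x + y) / 2\<bar> powr p)"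
proof -
  define \<psi> :: "real \<Rightarrow> real" where "\<psi> t = (1 + \<bar>t\<bar> powr p) / 2 - \<bar>(1 + t) / 2\<bar> powr p" for t
  have \<psi>_nonneg: "0 \<le> \<psi> t" for t 
    using abs_powr_midpoint_le[OF p, of 1 t] by (simp add: \<psi>_def)
  have \<psi>_pos: "0 < \<psi> t" if "t \<noteq> 1" for t 
    using abs_powr_midpoint_less[OF p, of 1 t] that by (simp add: \<psi>_def)
  have cont: "continuous_on S \<psi>" for S
    unfolding \<psi>_def using p by (intro continuous_intros continuous_on_powr') auto
  define A where "A = {t \<in> {-1..1::real}. \<epsilon> \<le> \<bar>1 - t\<bar> powr p}"
  have "compact A"
  proof -
    have "continuous_on UNIV (\<lambda>t::real. \<bar>1 - t\<bar> powr p)" 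
      using p by (intro continuous_intros continuous_on_powr') auto
    then have "closed {t::real. \<epsilon> \<le> \<bar>1 - t\<bar> powr p}"
      by (intro closed_Collect_le continuous_on_const)
    then have "compact ({-1..1} \<inter> {t::real. \<epsilon> \<le> \<bar>1 - t\<bar> powr p})"
      by (intro compact_Int_closed) auto
    then show ?thesis by (simp add: A_def Int_def)
  qed
  \<comment> \<open>The point 1 is not in \<open>A\<close>, so the minimum of \<open>\<psi>\<close>
    over the compact set \<open>A\<close> is positive. If \<open>A\<close> is empty, any \<delta>
    will do.\<close>
  obtain \<delta> where \<delta>: "0 < \<delta>" "\<And>t. t \<in> A \<Longrightarrow> \<delta> \<le> \<psi> t"
  proof (cases "A = {}")
    case False
    obtain t where t: "t \<in> A" "\<And>s. s \<in> A \<Longrightarrow> \<psi> t \<le> \<psi> s"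
      using continuous_attains_inf[OF \<open>compact A\<close> False cont] by blast
    have "t \<noteq> 1" using t(1) \<epsilon> by (auto simp: A_def)
    then show ?thesis using that t \<psi>_pos by blast
  qed (use that[of 1] in auto)
  \<comment> \<open>For |t| <= 1 the left-hand side is at most \<open>2 powr p\<close>, which equals
    \<open>K * \<delta>\<close>. So on \<open>A\<close> the defect term alone dominates, while off
    \<open>A\<close> the \<epsilon> term does.\<close>
  define K where "K = 2 powr p / \<delta>"
  have K: "0 \<le> K" using \<delta> by (simp add: K_def)
  have normalised: "\<bar>1 - t\<bar> powr p \<le> \<epsilon> * (1 + \<bar>t\<bar> powr p) + K * \<psi> t" if t: "\<bar>t\<bar> \<le> 1" for t
  proof (cases "t \<in> A")
    case True
    have "\<bar>1 - t\<bar> powr p \<le> 2 powr p" using t p by (intro powr_mono2) auto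
    also have "\<dots> = K * \<delta>" using \<delta> by (simp add: K_def)
    also have "\<dots> \<le> K * \<psi> t" using K \<delta>(2)[OF True] by (intro mult_left_mono) auto
    finally show ?thesis using \<epsilon> by (smt (verit) mult_nonneg_nonneg powr_ge_zero)
  next
    case False
    then have "\<bar>1 - t\<bar> powr p \<le> \<epsilon> * 1" using t by (auto simp: A_def)
    also have "\<dots> \<le> \<epsilon> * (1 + \<bar>t\<bar> powr p)" using \<epsilon> by (intro mult_left_mono) auto
    finally show ?thesis using K \<psi>_nonneg[of t] by (smt (verit) mult_nonneg_nonneg)
  qed
  have main: "\<bar>x - y\<bar> powr p \<le>
       \<epsilon> * (\<bar>x\<bar> powr p + \<bar>y\<bar> powr p) + K * ((\<bar>x\<bar> powr p + \<bar>y\<bar> powr p) / 2 - \<bar>(x + y) / 2\<bar> powr p)"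
    if "\<bar>y\<bar> \<le> \<bar>x\<bar>" for x y :: real
  proof (cases "x = 0")
    case True
    then show ?thesis using that by simp
  next
    case False
    define t where "t = y / x"
    have y: "y = x * t" using False by (simp add: t_def)
    have t: "\<bar>t\<bar> \<le> 1" using that False by (simp add: t_def)
    have "x - y = x * (1 - t)" "(x + y) / 2 = x * ((1 + t) / 2)" by (auto simp: y field_simps)
    then have eqs: "\<bar>x - y\<bar> powr p = \<bar>x\<bar> powr p * \<bar>1 - t\<bar> powr p"
      "\<bar>(x + y) / 2\<bar> powr p = \<bar>x\<bar> powr p * \<bar>(1 + t) / 2\<bar> powr p"
      "\<bar>y\<bar> powr p = \<bar>x\<bar> powr p * \<bar>t\<bar> powr p"
      unfolding y by (simp_all only: abs_mult powr_mult abs_ge_zero)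
    have "\<bar>x\<bar> powr p * \<bar>1 - t\<bar> powr p \<le> \<bar>x\<bar> powr p * (\<epsilon> * (1 + \<bar>t\<bar> powr p) + K * \<psi> t)"
      using normalised[OF t] by (intro mult_left_mono) auto
    then show ?thesis unfolding eqs \<psi>_def by (simp add: algebra_simps)
  qed
  show ?thesis
  proof (rule that[OF K])
    fix x y :: real
    show "\<bar>x - y\<bar> powr p \<le>
       \<epsilon> * (\<bar>x\<bar> powr p + \<bar>y\<bar> powr p) + K * ((\<bar>x\<bar> powr p + \<bar>y\<bar> powr p) / 2 - \<bar>(x + y) / 2\<bar> powr p)"
      using main[of x y] main[of y x] by (cases "\<bar>y\<bar> \<le> \<bar>x\<bar>") (auto simp: add.commute abs_minus_commute)
  qed
qed

section \<open>The vector space \<open>Lp p M\<close> and the integral of |f|^p\<close>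

lemma Lp_measurable [measurable_dest]: "f \<in> Lp p M \<Longrightarrow> f \<in> borel_measurable M"
  by (simp add: Lp_def)

lemma Lp_integrable: "f \<in> Lp p M \<Longrightarrow> integrable M (\<lambda>x. \<bar>f x\<bar> powr p)"
  by (simp add: Lp_def)

lemma Lp_add:
  assumes "f \<in> Lp p M" "g \<in> Lp p M" "0 \<le> p"
  shows "(\<lambda>x. f x + g x) \<in> Lp p M"
proof -
  have [measurable]: "f \<in> borel_measurable M" "g \<in> borel_measurable M"
    using assms by (auto simp: Lp_def)
  have "integrable M (\<lambda>x. 2 powr p * (\<bar>f x\<bar> powr p + \<bar>g x\<bar> powr p))"
    using assms by (intro integrable_mult_right Bochner_Integration.integrable_add Lp_integrable)
  then have "integrable M (\<lambda>x. \<bar>f x + g x\<bar> powr p)"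
    by (rule Bochner_Integration.integrable_bound) (use abs_powr_add_le[OF assms(3)] in auto)
  then show ?thesis by (simp add: Lp_def)
qed

lemma Lp_scale:
  assumes "f \<in> Lp p M"
  shows "(\<lambda>x. c * f x) \<in> Lp p M"
  using assms by (auto simp: Lp_def abs_mult powr_mult)

lemma Lp_diff:
  assumes "f \<in> Lp p M" "g \<in> Lp p M" "0 \<le> p"
  shows "(\<lambda>x. f x - g x) \<in> Lp p M"
  using Lp_add[OF assms(1) Lp_scale[OF assms(2), of "-1"] assms(3)] by simp

lemma Lp_modular_nonneg [simp]: "0 \<le> Lp_modular p M f"
  by (simp add: Lp_modular_def integral_nonneg_AE)

lemma Lp_modular_scale: "Lp_modular p M (\<lambda>x. c * f x) = \<bar>c\<bar> powr p * Lp_modular p M f"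
  by (simp add: Lp_modular_def abs_mult powr_mult)

lemma Lp_modular_add_le:
  assumes "f \<in> Lp p M" "g \<in> Lp p M" "0 \<le> p"
  shows "Lp_modular p M (\<lambda>x. f x + g x) \<le> 2 powr p * (Lp_modular p M f + Lp_modular p M g)"
proof -
  have "Lp_modular p M (\<lambda>x. f x + g x) \<le> (LINT x|M. 2 powr p * (\<bar>f x\<bar> powr p + \<bar>g x\<bar> powr p))"
    unfolding Lp_modular_def
    using assms Lp_add[OF assms] abs_powr_add_le[OF assms(3)]
    by (intro integral_mono integrable_mult_right Bochner_Integration.integrable_add Lp_integrable) auto
  then show ?thesis using assms by (simp add: Lp_modular_def Lp_integrable)
qed

lemma Lp_modular_diff_le:
  assumes "f \<in> Lp p M" "g \<in> Lp p M" "0 \<le> p"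
  shows "Lp_modular p M (\<lambda>x. f x - g x) \<le> 2 powr p * (Lp_modular p M f + Lp_modular p M g)"
  using Lp_modular_add_le[OF assms(1) Lp_scale[OF assms(2), of "-1"] assms(3)]
    Lp_modular_scale[of p M "-1" g] by simp

lemma Lp_modular_cong_AE:
  assumes "f \<in> borel_measurable M" "g \<in> borel_measurable M" "AE x in M. f x = g x"
  shows "Lp_modular p M f = Lp_modular p M g"
  unfolding Lp_modular_def using assms by (intro integral_cong_AE) auto

lemma Lp_modular_eq_0_iff:
  assumes "f \<in> Lp p M"
  shows "Lp_modular p M f = 0 \<longleftrightarrow> (AE x in M. f x = 0)"
  unfolding Lp_modular_def
  using integral_nonneg_eq_0_iff_AE[OF Lp_integrable[OF assms]] by (simp add: powr_eq_0_iff)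

lemma Lp_midpoint:
  assumes "f \<in> Lp p M" "g \<in> Lp p M" "0 \<le> p"
  shows "(\<lambda>x. (f x + g x) / 2) \<in> Lp p M"
  using Lp_scale[OF Lp_add[OF assms], of "1/2"] by simp

lemma Lp_modular_midpoint_le:
  assumes "f \<in> Lp p M" "g \<in> Lp p M" "1 < p"
  shows "Lp_modular p M (\<lambda>x. (f x + g x) / 2) \<le> (Lp_modular p M f + Lp_modular p M g) / 2"
proof -
  have "Lp_modular p M (\<lambda>x. (f x + g x) / 2) \<le> (LINT x|M. (\<bar>f x\<bar> powr p + \<bar>g x\<bar> powr p) / 2)"
    unfolding Lp_modular_def
    using assms abs_powr_midpoint_le[OF assms(3)]
    by (intro integral_mono integrable_divide Bochner_Integration.integrable_add Lp_integrable Lp_midpoint) auto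
  then show ?thesis using assms by (simp add: Lp_modular_def Lp_integrable)
qed

text \<open>The pointwise inequality is linear in the p-th powers, so it integrates term by term.
  One \<open>K\<close> serves all f and g, which allows it to be fixed before the members of a
  sequence are chosen.\<close>

lemma Lp_modular_uniform_convexity:
  assumes p: "1 < p" and \<epsilon>: "0 < \<epsilon>"
  obtains K where "0 \<le> K"
    "\<And>f g. f \<in> Lp p M \<Longrightarrow> g \<in> Lp p M \<Longrightarrow> Lp_modular p M (\<lambda>x. f x - g x) \<le>
       \<epsilon> * (Lp_modular p M f + Lp_modular p M g) +
       K * ((Lp_modular p M f + Lp_modular p M g) / 2 - Lp_modular p M (\<lambda>x. (f x + g x) / 2))"
proof -
  obtain K where K: "0 \<le> K"
    "\<And>x y :: real. \<bar>x - y\<bar> powr p \<le>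
       \<epsilon> * (\<bar>x\<bar> powr p + \<bar>y\<bar> powr p) + K * ((\<bar>x\<bar> powr p + \<bar>y\<bar> powr p) / 2 - \<bar>(x + y) / 2\<bar> powr p)"
    using abs_powr_uniform_convexity[OF p \<epsilon>] by blast
  show ?thesis
  proof (rule that[OF K(1)])
    fix f g assume fg: "f \<in> Lp p M" "g \<in> Lp p M"
    have ints: "integrable M (\<lambda>x. \<bar>f x\<bar> powr p)" "integrable M (\<lambda>x. \<bar>g x\<bar> powr p)"
      "integrable M (\<lambda>x. \<bar>f x - g x\<bar> powr p)" "integrable M (\<lambda>x. \<bar>(f x + g x) / 2\<bar> powr p)"
      using fg p Lp_integrable[OF Lp_diff[OF fg]] Lp_integrable[OF Lp_midpoint[OF fg]]
      by (auto intro: Lp_integrable)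
    have "Lp_modular p M (\<lambda>x. f x - g x) \<le> (LINT x|M. 
       \<epsilon> * (\<bar>f x\<bar> powr p + \<bar>g x\<bar> powr p) + K * ((\<bar>f x\<bar> powr p + \<bar>g x\<bar> powr p) / 2 - \<bar>(f x + g x) / 2\<bar> powr p))"
      unfolding Lp_modular_def
      by (intro integral_mono ints K(2) Bochner_Integration.integrable_add
           Bochner_Integration.integrable_diff integrable_mult_right integrable_divide)
    also have "\<dots> = \<epsilon> * (Lp_modular p M f + Lp_modular p M g) +
       K * ((Lp_modular p M f + Lp_modular p M g) / 2 - Lp_modular p M (\<lambda>x. (f x + g x) / 2))"
      unfolding Lp_modular_def using ints by (simp del: abs_divide)
    finally show "Lp_modular p M (\<lambda>x. f x - g x) \<le>
       \<epsilon> * (Lp_modular p M f + Lp_modular p M g) +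
       K * ((Lp_modular p M f + Lp_modular p M g) / 2 - Lp_modular p M (\<lambda>x. (f x + g x) / 2))" .
  qed
qed

lemma nn_integral_Lp_modular:
  "f \<in> Lp p M \<Longrightarrow> (\<integral>\<^sup>+x. ennreal (\<bar>f x\<bar> powr p) \<partial>M) = ennreal (Lp_modular p M f)"
  unfolding Lp_modular_def by (intro nn_integral_eq_integral Lp_integrable) auto

section \<open>Completeness and minimising sequences\<close>

text \<open>This follows the Riesz-Fischer argument: a fast subsequence converges almost everywhere,
  and Fatou's lemma carries the Cauchy estimate over to its limit.\<close>

lemma Lp_complete:
  fixes f :: "nat \<Rightarrow> 'a \<Rightarrow> real"
  assumes p: "0 < p" and f: "\<And>n. f n \<in> Lp p M"
    and Cauchy: "\<And>e. 0 < e \<Longrightarrow> \<exists>k. \<forall>m\<ge>k. \<forall>n\<ge>k. Lp_modular p M (\<lambda>x. f m x - f n x) \<le> e"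
  obtains g where "g \<in> Lp p M" "(\<lambda>n. Lp_modular p M (\<lambda>x. f n x - g x)) \<longlonglongrightarrow> 0"
proof -
  have [measurable]: "f n \<in> borel_measurable M" for n using f by (simp add: Lp_def)
  \<comment> \<open>Along \<open>r\<close> the increments \<open>h\<close> are so small that \<open>2\<^sup>k h\<^sub>k\<close> is \<open>p\<close>-summable almost everywhere, hence
    eventually \<open>\<bar>h\<^sub>k\<bar> \<le> (1/2)\<^sup>k\<close>.\<close>
  define e :: "nat \<Rightarrow> real" where "e k = (1/2) ^ k / (2 ^ k) powr p" for k
  have "0 < e k" for k by (simp add: e_def)
  then have "\<forall>k. \<exists>l. \<forall>m\<ge>l. \<forall>n\<ge>l. Lp_modular p M (\<lambda>x. f m x - f n x) \<le> e k"
    using Cauchy by blast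
  then obtain l where l: "\<And>k m n. l k \<le> m \<Longrightarrow> l k \<le> n \<Longrightarrow> Lp_modular p M (\<lambda>x. f m x - f n x) \<le> e k"
    by metis
  \<comment> \<open>The sum makes \<open>r\<close> nondecreasing and at least \<open>l k\<close> at
    k, hence also at \<open>Suc k\<close>, so both indices of the k-th increment lie beyond
    \<open>l k\<close>. The summand k drives \<open>r\<close> to infinity.\<close>
  define r where "r k = (\<Sum>i\<le>k. l i) + k" for k
  have r: "l k \<le> r k" "l k \<le> r (Suc k)" "k \<le> r k" for k
    using member_le_sum[of k "{..k}" l] by (auto simp: r_def)
  define h where "h k x = f (r (Suc k)) x - f (r k) x" for k x
  have [measurable]: "h k \<in> borel_measurable M" for k unfolding h_def by measurable
  have hLp: "h k \<in> Lp p M" for k unfolding h_def using p by (intro Lp_diff f) auto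
  have "Lp_modular p M (\<lambda>x. 2 ^ k * h k x) \<le> (1/2) ^ k" for k
  proof -
    have "Lp_modular p M (\<lambda>x. 2 ^ k * h k x) = (2 ^ k) powr p * Lp_modular p M (h k)"
      by (simp add: Lp_modular_scale)
    also have "\<dots> \<le> (2 ^ k) powr p * e k"
      using l[OF r(2,1)] by (intro mult_left_mono) (auto simp: h_def[abs_def])
    finally show ?thesis by (simp add: e_def)
  qed
  then have "(\<Sum>k. ennreal (Lp_modular p M (\<lambda>x. 2 ^ k * h k x))) \<le> (\<Sum>k. ennreal ((1/2) ^ k))"
    by (intro suminf_le ennreal_leI) auto
  also have "\<dots> = ennreal (\<Sum>k. (1/2) ^ k)"
    by (intro suminf_ennreal2) (auto intro: summable_geometric)
  also have "\<dots> < \<infinity>" by simp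
  finally have fin: "(\<Sum>k. ennreal (Lp_modular p M (\<lambda>x. 2 ^ k * h k x))) < \<infinity>" .
  have "(\<integral>\<^sup>+x. (\<Sum>k. ennreal (\<bar>2 ^ k * h k x\<bar> powr p)) \<partial>M) = (\<Sum>k. ennreal (Lp_modular p M (\<lambda>x. 2 ^ k * h k x)))"
    by (subst nn_integral_suminf) (auto simp: nn_integral_Lp_modular Lp_scale hLp)
  then have "AE x in M. (\<Sum>k. ennreal (\<bar>2 ^ k * h k x\<bar> powr p)) \<noteq> \<infinity>"
    using fin by (intro nn_integral_PInf_AE) auto
  then have conv: "AE x in M. convergent (\<lambda>k. f (r k) x)"
  proof (rule AE_mp, intro AE_I2 impI)
    fix x assume "(\<Sum>k. ennreal (\<bar>2 ^ k * h k x\<bar> powr p)) \<noteq> \<infinity>"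
    then have "summable (\<lambda>k. \<bar>2 ^ k * h k x\<bar> powr p)"
      by (intro summable_suminf_not_top) auto
    then have "(\<lambda>k. \<bar>2 ^ k * h k x\<bar> powr p) \<longlonglongrightarrow> 0" by (rule summable_LIMSEQ_zero)
    then have "eventually (\<lambda>k. \<bar>2 ^ k * h k x\<bar> powr p < 1) sequentially"
      by (rule order_tendstoD) simp
    then have "eventually (\<lambda>k. norm (h k x) \<le> (1/2) ^ k) sequentially"
    proof (rule eventually_mono)
      fix k assume "\<bar>2 ^ k * h k x\<bar> powr p < 1"
      then have "\<not> 1 \<le> \<bar>2 ^ k * h k x\<bar>" using ge_one_powr_ge_zero[of "\<bar>2 ^ k * h k x\<bar>" p] p by linarith
      then show "norm (h k x) \<le> (1/2) ^ k" by (simp add: abs_mult field_simps power_one_over)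
    qed
    then have "summable (\<lambda>k. h k x)" by (rule summable_comparison_test_ev) (auto intro: summable_geometric)
    then have "convergent (\<lambda>n. (\<Sum>k<n. h k x) + f (r 0) x)"
      by (intro convergent_add convergent_const) (simp add: summable_iff_convergent)
    then show "convergent (\<lambda>k. f (r k) x)"
      using sum_lessThan_telescope[of "\<lambda>k. f (r k) x"] by (simp add: h_def)
  qed
  define g where "g x = lim (\<lambda>k. f (r k) x)" for x
  have [measurable]: "g \<in> borel_measurable M" unfolding g_def by measurable
  have lim: "AE x in M. (\<lambda>k. f (r k) x) \<longlonglongrightarrow> g x"
    using conv by eventually_elim (simp add: g_def convergent_LIMSEQ_iff)
  \<comment> \<open>With \<open>f n\<close> kept fixed, Fatou's lemma is applied to
    \<open>f n - f (r j)\<close> as j grows. The nonnegative integral is used because integrability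
    of the limit is only deduced from this bound.\<close>
  have fatou: "(\<integral>\<^sup>+x. ennreal (\<bar>f n x - g x\<bar> powr p) \<partial>M) \<le> ennreal d"
    if n: "k \<le> n" and k: "\<And>m n. k \<le> m \<Longrightarrow> k \<le> n \<Longrightarrow> Lp_modular p M (\<lambda>x. f m x - f n x) \<le> d" for n k d
  proof -
    have "(\<integral>\<^sup>+x. ennreal (\<bar>f n x - g x\<bar> powr p) \<partial>M)
        = (\<integral>\<^sup>+x. liminf (\<lambda>j. ennreal (\<bar>f n x - f (r j) x\<bar> powr p)) \<partial>M)"
    proof (rule nn_integral_cong_AE, use lim in eventually_elim)
      fix x assume "(\<lambda>j. f (r j) x) \<longlonglongrightarrow> g x"
      then have "(\<lambda>j. ennreal (\<bar>f n x - f (r j) x\<bar> powr p)) \<longlonglongrightarrow> ennreal (\<bar>f n x - g x\<bar> powr p)"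
        using p by (intro tendsto_intros tendsto_ennrealI tendsto_powr') auto
      then show "ennreal (\<bar>f n x - g x\<bar> powr p) = liminf (\<lambda>j. ennreal (\<bar>f n x - f (r j) x\<bar> powr p))"
        using lim_imp_Liminf[OF trivial_limit_sequentially] by metis
    qed
    also have "\<dots> \<le> liminf (\<lambda>j. \<integral>\<^sup>+x. ennreal (\<bar>f n x - f (r j) x\<bar> powr p) \<partial>M)"
      by (intro nn_integral_liminf) measurable
    also have "\<dots> = liminf (\<lambda>j. ennreal (Lp_modular p M (\<lambda>x. f n x - f (r j) x)))"
      using p f by (simp add: nn_integral_Lp_modular Lp_diff)
    also have "\<dots> \<le> limsup (\<lambda>j. ennreal (Lp_modular p M (\<lambda>x. f n x - f (r j) x)))"
      by (intro Liminf_le_Limsup) auto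
    also have "\<dots> \<le> ennreal d"
    proof (rule Limsup_bounded)
      show "eventually (\<lambda>j. ennreal (Lp_modular p M (\<lambda>x. f n x - f (r j) x)) \<le> ennreal d) sequentially"
        using eventually_ge_at_top[of k]
      proof eventually_elim
        fix j assume "k \<le> j"
        then have "k \<le> r j" using r(3)[of j] by linarith
        then show "ennreal (Lp_modular p M (\<lambda>x. f n x - f (r j) x)) \<le> ennreal d"
          using k[OF n] by (intro ennreal_leI) auto
      qed
    qed
    finally show ?thesis .
  qed
  have tail: "\<exists>k. \<forall>n\<ge>k. (\<lambda>x. f n x - g x) \<in> Lp p M \<and> Lp_modular p M (\<lambda>x. f n x - g x) \<le> d" if d: "0 < d" for d
  proof -
    obtain k where k: "\<And>m n. k \<le> m \<Longrightarrow> k \<le> n \<Longrightarrow> Lp_modular p M (\<lambda>x. f m x - f n x) \<le> d"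
      using Cauchy[OF d] by blast
    have "(\<lambda>x. f n x - g x) \<in> Lp p M \<and> Lp_modular p M (\<lambda>x. f n x - g x) \<le> d" if n: "k \<le> n" for n
    proof
      have "(\<integral>\<^sup>+x. ennreal (norm (\<bar>f n x - g x\<bar> powr p)) \<partial>M) < \<infinity>"
        using fatou[OF n k] by (auto simp: le_less_trans)
      then have "integrable M (\<lambda>x. \<bar>f n x - g x\<bar> powr p)" by (intro integrableI_bounded) auto
      then show "(\<lambda>x. f n x - g x) \<in> Lp p M" by (simp add: Lp_def)
      from nn_integral_Lp_modular[OF this] show "Lp_modular p M (\<lambda>x. f n x - g x) \<le> d"
        using fatou[OF n k] d by (simp add: ennreal_le_iff)
    qed
    then show ?thesis by blast
  qed
  show ?thesis
  proof (rule that)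
    obtain k where "(\<lambda>x. f k x - g x) \<in> Lp p M" using tail[of 1] by auto
    \<comment> \<open>The limit is recovered as \<open>f k - (f k - g)\<close>.\<close>
    then show "g \<in> Lp p M" using Lp_diff[OF f[of k], of "\<lambda>x. f k x - g x"] p by simp
    show "(\<lambda>n. Lp_modular p M (\<lambda>x. f n x - g x)) \<longlonglongrightarrow> 0"
    proof (rule LIMSEQ_I)
      fix d :: real assume "0 < d"
      then obtain k where "\<forall>n\<ge>k. Lp_modular p M (\<lambda>x. f n x - g x) \<le> d / 2" using tail[of "d/2"] by auto
      then show "\<exists>k. \<forall>n\<ge>k. norm (Lp_modular p M (\<lambda>x. f n x - g x) - 0) < d"
        using \<open>0 < d\<close> by (intro exI[of _ k]) (fastforce simp: field_simps)
    qed
  qed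
qed

text \<open>The infima of the modular over \<open>C n\<close> increase to some
  \<open>D \<le> R\<close>. For near-minimisers \<open>v m\<close> and \<open>v n\<close> with m, n
  >= k, the midpoint lies in \<open>C k\<close>, so its modular is at least the k-th infimum. The
  convexity defect is then small, and uniform convexity gives the Cauchy property. The sets need not
  be closed, so the limit is not claimed to lie in them.\<close>

lemma Lp_decreasing_midpoint_convex_Cauchy:
  fixes C :: "nat \<Rightarrow> ('a \<Rightarrow> real) set"
  assumes p: "1 < p"
    and Lp: "\<And>n. C n \<subseteq> Lp p M"
    and anti: "\<And>m n. m \<le> n \<Longrightarrow> C n \<subseteq> C m"
    and mid: "\<And>n f g. f \<in> C n \<Longrightarrow> g \<in> C n \<Longrightarrow> (\<lambda>x. (f x + g x) / 2) \<in> C n"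
    and bdd: "\<And>n. \<exists>f\<in>C n. Lp_modular p M f \<le> R"
  obtains v g where "\<And>n. v n \<in> C n"
    "(\<lambda>n. Lp_modular p M (\<lambda>x. v n x - g x)) \<longlonglongrightarrow> 0" "g \<in> Lp p M"
proof -
  define d where "d n = Inf (Lp_modular p M ` C n)" for n
  have bb: "bdd_below (Lp_modular p M ` A)" for A :: "('a \<Rightarrow> real) set"
    by (rule bdd_belowI2[of _ 0]) simp
  have ne: "C n \<noteq> {}" for n using bdd by blast
  have d_le: "d n \<le> Lp_modular p M f" if "f \<in> C n" for n f
    unfolding d_def using that by (intro cInf_lower bb) auto
  have d_R: "d n \<le> R" for n using bdd[of n] d_le by force
  have inc: "incseq d"
    unfolding d_def by (intro incseq_SucI cInf_superset_mono bb image_mono anti) (use ne in auto)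
  obtain D where D: "d \<longlonglongrightarrow> D" "\<And>n. d n \<le> D"
    using incseq_convergent[OF inc, of R] d_R by blast
  have DR: "D \<le> R" using D(1) d_R by (intro LIMSEQ_le_const2) auto
  have "\<exists>f\<in>C n. Lp_modular p M f < d n + 1 / Suc n" for n
    using cInf_lessD[of "Lp_modular p M ` C n" "d n + 1 / Suc n"] ne by (auto simp: d_def)
  then obtain v where v: "\<And>n. v n \<in> C n" "\<And>n. Lp_modular p M (v n) < d n + 1 / Suc n" by metis
  have vLp: "v n \<in> Lp p M" for n using v(1) Lp by blast
  \<comment> \<open>\<open>q k\<close> will bound the convexity defect of \<open>v m\<close> and
    \<open>v n\<close> for m, n >= k: their modulars are at most \<open>D + 1 / Suc k\<close>, and
    that of the midpoint is at least \<open>d k\<close>.\<close>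
  define q where "q n = D - d n + 1 / Suc n" for n
  have q: "q \<longlonglongrightarrow> 0"
  proof -
    have "(\<lambda>n. D - d n + inverse (real (Suc n))) \<longlonglongrightarrow> D - D + 0"
      by (intro tendsto_intros D(1) LIMSEQ_inverse_real_of_nat)
    then show ?thesis by (simp add: q_def[abs_def] inverse_eq_divide)
  qed
  have est: "(Lp_modular p M (v m) + Lp_modular p M (v n)) / 2 - Lp_modular p M (\<lambda>x. (v m x + v n x) / 2) \<le> q k"
    if "k \<le> m" "k \<le> n" for k m n
  proof -
    have "(\<lambda>x. (v m x + v n x) / 2) \<in> C k"
      using v(1)[of m] v(1)[of n] anti that by (intro mid) auto
    then have "d k \<le> Lp_modular p M (\<lambda>x. (v m x + v n x) / 2)" by (rule d_le)
    moreover have "1 / Suc m \<le> 1 / Suc k" "1 / Suc n \<le> 1 / Suc k" using that by (auto simp: frac_le)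
    ultimately show ?thesis using v(2)[of m] v(2)[of n] D(2)[of m] D(2)[of n] unfolding q_def by argo
  qed
  have "\<exists>k. \<forall>m\<ge>k. \<forall>n\<ge>k. Lp_modular p M (\<lambda>x. v m x - v n x) \<le> e" if e: "0 < e" for e
  proof -
    have R: "0 \<le> R" using bdd[of 0] Lp_modular_nonneg order_trans by blast
    \<comment> \<open>Each \<open>v j\<close> has modular at most \<open>R + 1\<close>, so the
      \<epsilon> term contributes at most e/2 and leaves e/2 for the defect term.\<close>
    define \<epsilon> where "\<epsilon> = e / (4 * (R + 1))"
    have \<epsilon>: "0 < \<epsilon>" using e R by (simp add: \<epsilon>_def)
    obtain K where K: "0 \<le> K" "\<And>f g. f \<in> Lp p M \<Longrightarrow> g \<in> Lp p M \<Longrightarrow> Lp_modular p M (\<lambda>x. f x - g x) \<le>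
       \<epsilon> * (Lp_modular p M f + Lp_modular p M g) +
       K * ((Lp_modular p M f + Lp_modular p M g) / 2 - Lp_modular p M (\<lambda>x. (f x + g x) / 2))"
      using Lp_modular_uniform_convexity[OF p \<epsilon>, of M] by blast
    have "(\<lambda>k. K * q k) \<longlonglongrightarrow> 0" using tendsto_mult_right_zero[OF q] by simp
    then obtain k where k: "K * q k < e / 2"
      using order_tendstoD(2)[of "\<lambda>k. K * q k" 0 sequentially "e/2"] e
      by (auto simp: eventually_sequentially)
    have "Lp_modular p M (\<lambda>x. v m x - v n x) \<le> e" if mn: "k \<le> m" "k \<le> n" for m n
    proof -
      have le: "Lp_modular p M (v j) \<le> R + 1" for j
      proof -
        have "1 / real (Suc j) \<le> 1" by simp
        then show ?thesis using v(2)[of j] d_R[of j] by linarith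
      qed
      have "\<epsilon> * (Lp_modular p M (v m) + Lp_modular p M (v n)) \<le> \<epsilon> * (2 * (R + 1))"
        using \<epsilon> le[of m] le[of n] by (intro mult_left_mono) auto
      also have "\<dots> = e / 2" using R by (simp add: \<epsilon>_def field_simps)
      finally show ?thesis using K(2)[OF vLp vLp, of m n] mult_left_mono[OF est[OF mn] K(1)] k by linarith
    qed
    then show ?thesis by blast
  qed
  from Lp_complete[OF _ vLp this] p obtain g where "g \<in> Lp p M" "(\<lambda>n. Lp_modular p M (\<lambda>x. v n x - g x)) \<longlonglongrightarrow> 0"
    by auto
  then show ?thesis using that v(1) by blast
qed

section \<open>Bounded resolvent families\<close>

lemma Lp_norm_conv_modular: "Lp_norm p M f = Lp_modular p M f powr (1 / p)"
  by (simp add: Lp_norm_def Lp_modular_def)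

lemma Lp_modular_conv_norm: "p \<noteq> 0 \<Longrightarrow> Lp_modular p M f = Lp_norm p M f powr p"
  by (simp add: Lp_norm_conv_modular powr_powr)

lemma Lp_norm_nonneg [simp]: "0 \<le> Lp_norm p M f"
  by (simp add: Lp_norm_def)

lemma Lp_norm_scale: "p \<noteq> 0 \<Longrightarrow> Lp_norm p M (\<lambda>x. c * f x) = \<bar>c\<bar> * Lp_norm p M f"
  by (simp add: Lp_norm_conv_modular Lp_modular_scale powr_mult powr_powr)

text \<open>The constant \<open>C\<close> makes the quotients bounded above, so that the real
  supremum is a genuine upper bound. It also settles f of norm zero, about which the quotient says
  nothing.\<close>

lemma Lp_norm_le_onorm:
  assumes C: "\<And>f. f \<in> Lp p M \<Longrightarrow> Lp_norm p M (T f) \<le> C * Lp_norm p M f" and f: "f \<in> Lp p M"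
  shows "Lp_norm p M (T f) \<le> Lp_onorm p M T * Lp_norm p M f"
proof (cases "Lp_norm p M f = 0")
  case True
  then show ?thesis using C[OF f] by simp
next
  case False
  \<comment> \<open>The maximum with 0 covers g of norm zero, where division by zero yields 0, even
    if \<open>C\<close> is negative.\<close>
  have "Lp_norm p M (T g) / Lp_norm p M g \<le> max C 0" if "g \<in> Lp p M" for g
  proof (cases "Lp_norm p M g = 0")
    case False
    then have "Lp_norm p M (T g) / Lp_norm p M g \<le> C"
      using C[OF that] Lp_norm_nonneg[of p M g] by (simp add: field_simps del: Lp_norm_nonneg)
    then show ?thesis by simp
  qed simp
  then have "bdd_above ((\<lambda>g. Lp_norm p M (T g) / Lp_norm p M g) ` Lp p M)"
    by (rule bdd_aboveI2)
  then have "Lp_norm p M (T f) / Lp_norm p M f \<le> Lp_onorm p M T"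
    unfolding Lp_onorm_def using f by (rule cSUP_upper2) simp
  then show ?thesis using False Lp_norm_nonneg[of p M f] by (simp add: field_simps del: Lp_norm_nonneg)
qed

lemma Lp_bounded_linear_combination:
  assumes T: "Lp_bounded_linear p M T" and fg: "f \<in> Lp p M" "g \<in> Lp p M"
  shows "AE x in M. T (\<lambda>y. a * f y + b * g y) x = a * T f x + b * T g x"
proof -
  have "AE x in M. T (\<lambda>y. a * f y + b * g y) x = T (\<lambda>y. a * f y) x + T (\<lambda>y. b * g y) x"
    "AE x in M. T (\<lambda>y. a * f y) x = a * T f x" "AE x in M. T (\<lambda>y. b * g y) x = b * T g x"
    using T fg Lp_scale[OF fg(1), of a] Lp_scale[OF fg(2), of b] by (auto simp: Lp_bounded_linear_def)
  then show ?thesis by eventually_elim simp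
qed

text \<open>The norm bound M enters here raised to the p-th power: \<open>B\<close> stands for
  \<open>M powr p\<close>, so that every estimate can be made on modulars.\<close>

locale Lp_bounded_resolvent =
  fixes p :: real and M :: "'a measure" and U :: "real \<Rightarrow> ('a \<Rightarrow> real) \<Rightarrow> 'a \<Rightarrow> real" and B :: real
  assumes p: "1 < p"
    and resolvent: "Lp_resolvent_family p M U"
    and bound: "\<And>\<alpha> f. 0 < \<alpha> \<Longrightarrow> f \<in> Lp p M \<Longrightarrow> Lp_modular p M (\<lambda>x. \<alpha> * U \<alpha> f x) \<le> B * Lp_modular p M f"
    and B_nonneg: "0 \<le> B"
begin

lemma p0: "0 \<le> p" using p by simp

lemma linear: "0 < \<alpha> \<Longrightarrow> Lp_bounded_linear p M (U \<alpha>)"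
  using resolvent by (simp add: Lp_resolvent_family_def)

lemma in_Lp [intro]: "0 < \<alpha> \<Longrightarrow> f \<in> Lp p M \<Longrightarrow> U \<alpha> f \<in> Lp p M"
  using linear by (simp add: Lp_bounded_linear_def)

lemma cong_AE:
  "0 < \<alpha> \<Longrightarrow> f \<in> Lp p M \<Longrightarrow> g \<in> Lp p M \<Longrightarrow> AE x in M. f x = g x \<Longrightarrow> AE x in M. U \<alpha> f x = U \<alpha> g x"
  using linear by (simp add: Lp_bounded_linear_def)

lemma combination:
  "0 < \<alpha> \<Longrightarrow> f \<in> Lp p M \<Longrightarrow> g \<in> Lp p M \<Longrightarrow>
    AE x in M. U \<alpha> (\<lambda>y. a * f y + b * g y) x = a * U \<alpha> f x + b * U \<alpha> g x"
  by (rule Lp_bounded_linear_combination[OF linear])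

lemma equation:
  "0 < \<alpha> \<Longrightarrow> 0 < \<beta> \<Longrightarrow> f \<in> Lp p M \<Longrightarrow> AE x in M. U \<alpha> f x - U \<beta> f x = (\<beta> - \<alpha>) * U \<alpha> (U \<beta> f) x"
  using resolvent by (simp add: Lp_resolvent_family_def)

section \<open>Algebra of the operators \<open>I - \<beta> U\<^sub>\<beta>\<close>\<close>

definition defect :: "real \<Rightarrow> ('a \<Rightarrow> real) \<Rightarrow> 'a \<Rightarrow> real" where
  "defect \<beta> f x = f x - \<beta> * U \<beta> f x"

lemma defect_in_Lp [intro]: "0 < \<beta> \<Longrightarrow> f \<in> Lp p M \<Longrightarrow> defect \<beta> f \<in> Lp p M"
  unfolding defect_def[abs_def] by (intro Lp_diff Lp_scale in_Lp p0)

lemma defect_combination: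
  assumes "0 < \<beta>" "f \<in> Lp p M" "g \<in> Lp p M"
  shows "AE x in M. defect \<beta> (\<lambda>y. a * f y + b * g y) x = a * defect \<beta> f x + b * defect \<beta> g x"
  using combination[OF assms, of a b] by eventually_elim (simp add: defect_def algebra_simps)

lemma modular_defect_le:
  assumes "0 < \<beta>" "f \<in> Lp p M"
  shows "Lp_modular p M (defect \<beta> f) \<le> 2 powr p * (1 + B) * Lp_modular p M f"
proof -
  have "Lp_modular p M (defect \<beta> f) \<le> 2 powr p * (Lp_modular p M f + Lp_modular p M (\<lambda>x. \<beta> * U \<beta> f x))"
    unfolding defect_def[abs_def] using assms by (intro Lp_modular_diff_le Lp_scale in_Lp p0)
  also have "\<dots> \<le> 2 powr p * (Lp_modular p M f + B * Lp_modular p M f)"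
    using bound[OF assms] by (intro mult_left_mono add_left_mono) auto
  finally show ?thesis by (simp add: algebra_simps)
qed

text \<open>In operator form: \<open>I - \<alpha> U\<^sub>\<alpha> = (I - \<beta> U\<^sub>\<beta>) (I + (\<beta> - \<alpha>) U\<^sub>\<alpha>)\<close>.\<close>

lemma defect_in_range:
  assumes "0 < \<alpha>" "0 < \<beta>" "u \<in> Lp p M"
  shows "AE x in M. u x - \<alpha> * U \<alpha> u x = defect \<beta> (\<lambda>y. u y + (\<beta> - \<alpha>) * U \<alpha> u y) x"
proof -
  have "AE x in M. U \<beta> (\<lambda>y. 1 * u y + (\<beta> - \<alpha>) * U \<alpha> u y) x = 1 * U \<beta> u x + (\<beta> - \<alpha>) * U \<beta> (U \<alpha> u) x"
    using assms by (intro combination in_Lp)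
  moreover have "AE x in M. U \<beta> u x - U \<alpha> u x = (\<alpha> - \<beta>) * U \<beta> (U \<alpha> u) x"
    using assms by (intro equation)
  ultimately show ?thesis
  proof eventually_elim
    case (elim x)
    have "U \<beta> (\<lambda>y. u y + (\<beta> - \<alpha>) * U \<alpha> u y) x = U \<alpha> u x" using elim by (simp add: algebra_simps)
    then show ?case by (simp add: defect_def algebra_simps)
  qed
qed

text \<open>The resolvent equation exchanges the two parameters. On the right,
  \<open>defect \<alpha>\<close> is bounded uniformly in \<alpha> by
  \<open>modular_defect_le\<close>, so the factor \<alpha> survives and gives decay as \<alpha>
  tends to 0.\<close>

lemma scaled_resolvent_defect:
  assumes "0 < \<alpha>" "0 < \<beta>" "w \<in> Lp p M"
  shows "AE x in M. \<alpha> * U \<alpha> (defect \<beta> w) x = \<alpha> * defect \<alpha> (U \<beta> w) x"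
proof -
  have "AE x in M. U \<alpha> (\<lambda>y. 1 * w y + (- \<beta>) * U \<beta> w y) x = 1 * U \<alpha> w x + (- \<beta>) * U \<alpha> (U \<beta> w) x"
    using assms by (intro combination in_Lp)
  moreover have "AE x in M. U \<alpha> w x - U \<beta> w x = (\<beta> - \<alpha>) * U \<alpha> (U \<beta> w) x"
    using assms by (intro equation)
  ultimately show ?thesis
  proof eventually_elim
    case (elim x)
    then have "U \<alpha> (defect \<beta> w) x = defect \<alpha> (U \<beta> w) x"
      by (simp add: defect_def[abs_def] algebra_simps)
    then show ?case by simp
  qed
qed

lemma modular_scaled_resolvent_defect_le:
  assumes "0 < \<alpha>" "0 < \<beta>" "w \<in> Lp p M"
  shows "Lp_modular p M (\<lambda>x. \<alpha> * U \<alpha> (defect \<beta> w) x) \<le>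
    \<alpha> powr p * (2 powr p * (1 + B) * Lp_modular p M (U \<beta> w))"
proof -
  have "Lp_modular p M (\<lambda>x. \<alpha> * U \<alpha> (defect \<beta> w) x) = Lp_modular p M (\<lambda>x. \<alpha> * defect \<alpha> (U \<beta> w) x)"
    using assms scaled_resolvent_defect[OF assms]
    by (intro Lp_modular_cong_AE Lp_measurable[of _ p] Lp_scale defect_in_Lp in_Lp)
  also have "\<dots> = \<alpha> powr p * Lp_modular p M (defect \<alpha> (U \<beta> w))"
    using assms by (simp add: Lp_modular_scale)
  finally show ?thesis using modular_defect_le[of \<alpha> "U \<beta> w"] assms by (simp add: mult_left_mono in_Lp)
qed

text \<open>The resolvents commute: for distinct parameters, interchange them in the resolvent
  equation and divide by \<open>\<beta> - \<alpha>\<close>. The decay estimate for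
  \<open>\<alpha> * U \<alpha> (defect \<beta> u)\<close> thereby applies to the defect of
  \<open>\<alpha> * U \<alpha> u\<close>.\<close>

lemma defect_scaled_resolvent:
  assumes "0 < \<alpha>" "0 < \<beta>" "u \<in> Lp p M"
  shows "AE x in M. defect \<beta> (\<lambda>y. \<alpha> * U \<alpha> u y) x = \<alpha> * U \<alpha> (defect \<beta> u) x"
proof -
  \<comment> \<open>The zero term gives homogeneity the two-term shape of
    \<open>combination\<close>; coefficients 1 serve the same purpose elsewhere.\<close>
  have "AE x in M. U \<beta> (\<lambda>y. \<alpha> * U \<alpha> u y + 0 * u y) x = \<alpha> * U \<beta> (U \<alpha> u) x + 0 * U \<beta> u x"
    using assms by (intro combination in_Lp)
  moreover have "AE x in M. U \<alpha> (\<lambda>y. 1 * u y + (- \<beta>) * U \<beta> u y) x = 1 * U \<alpha> u x + (- \<beta>) * U \<alpha> (U \<beta> u) x"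
    using assms by (intro combination in_Lp)
  moreover have "AE x in M. U \<alpha> (U \<beta> u) x = U \<beta> (U \<alpha> u) x"
  proof (cases "\<alpha> = \<beta>")
    case False
    have "AE x in M. U \<alpha> u x - U \<beta> u x = (\<beta> - \<alpha>) * U \<alpha> (U \<beta> u) x"
      "AE x in M. U \<beta> u x - U \<alpha> u x = (\<alpha> - \<beta>) * U \<beta> (U \<alpha> u) x"
      using assms by (auto intro: equation)
    then show ?thesis
    proof eventually_elim
      case (elim x)
      then have "(\<beta> - \<alpha>) * U \<alpha> (U \<beta> u) x = (\<beta> - \<alpha>) * U \<beta> (U \<alpha> u) x"
        by (simp add: algebra_simps)
      then show ?case using False by simp
    qed
  qed simp
  ultimately show ?thesis
  proof eventually_elim
    case (elim x)
    then have "U \<alpha> (defect \<beta> u) x = U \<alpha> u x - \<beta> * U \<beta> (U \<alpha> u) x"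
      by (simp add: defect_def[abs_def] algebra_simps)
    then have "\<alpha> * U \<alpha> (defect \<beta> u) x = \<alpha> * (U \<alpha> u x - \<beta> * U \<beta> (U \<alpha> u) x)"
      by simp
    also have "\<dots> = defect \<beta> (\<lambda>y. \<alpha> * U \<alpha> u y) x"
      using elim(1) by (simp add: defect_def algebra_simps)
    finally show ?case by simp
  qed
qed

text \<open>Applying \<open>U \<alpha>\<close> to \<open>v = \<beta> * U \<beta> v\<close> gives
  \<open>U \<alpha> v = \<beta> * U \<alpha> (U \<beta> v)\<close>. Inserted into the resolvent
  equation multiplied by \<beta>, this leaves
  \<open>\<alpha> * U \<alpha> v = \<beta> * U \<beta> v\<close>.\<close>

lemma fixed_point_independent:
  assumes "0 < \<alpha>" "0 < \<beta>" "v \<in> Lp p M" "AE x in M. defect \<beta> v x = 0"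
  shows "AE x in M. \<alpha> * U \<alpha> v x = v x"
proof -
  have "AE x in M. U \<alpha> v x = U \<alpha> (\<lambda>y. \<beta> * U \<beta> v y + 0 * v y) x"
    using assms by (intro cong_AE Lp_add Lp_scale in_Lp p0) (auto simp: defect_def)
  moreover have "AE x in M. U \<alpha> (\<lambda>y. \<beta> * U \<beta> v y + 0 * v y) x = \<beta> * U \<alpha> (U \<beta> v) x + 0 * U \<alpha> v x"
    using assms by (intro combination in_Lp)
  moreover have "AE x in M. U \<alpha> v x - U \<beta> v x = (\<beta> - \<alpha>) * U \<alpha> (U \<beta> v) x"
    using assms by (intro equation)
  ultimately show ?thesis using assms(4)
  proof eventually_elim
    case (elim x)
    have eq: "U \<alpha> v x = \<beta> * U \<alpha> (U \<beta> v) x" using elim(1,2) by simp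
    have "\<beta> * U \<alpha> v x - \<beta> * U \<beta> v x = (\<beta> - \<alpha>) * (\<beta> * U \<alpha> (U \<beta> v) x)"
      using elim(3) by (metis mult.left_commute right_diff_distrib)
    then have "\<alpha> * U \<alpha> v x = \<beta> * U \<beta> v x" unfolding eq[symmetric] by (simp add: algebra_simps)
    then show ?case using elim(4) by (simp add: defect_def)
  qed
qed

section \<open>Strong convergence of \<open>\<alpha> U\<^sub>\<alpha> u\<close>\<close>

lemma tendsto_modular:
  assumes \<beta>: "0 < \<beta>" and u: "u \<in> Lp p M"
  obtains v where "v \<in> Lp p M" "AE x in M. defect \<beta> v x = 0"
    "((\<lambda>\<alpha>. Lp_modular p M (\<lambda>x. \<alpha> * U \<alpha> u x - v x)) \<longlongrightarrow> 0) (at_right 0)"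
proof -
  define K where "K = 2 powr p * (1 + B)"
  have K: "0 \<le> K" using B_nonneg by (simp add: K_def)
  \<comment> \<open>This is the bound of \<open>modular_scaled_resolvent_defect_le\<close> for
    \<open>w = u\<close> and \<open>\<alpha> = 1 / (n + 1)\<close>.\<close>
  define c where "c n = inverse (real (Suc n)) powr p * (K * Lp_modular p M (U \<beta> u))" for n
  have c0: "c \<longlonglongrightarrow> 0"
  proof -
    have "(\<lambda>n. inverse (real (Suc n)) powr p * (K * Lp_modular p M (U \<beta> u))) \<longlonglongrightarrow> 0 powr p * (K * Lp_modular p M (U \<beta> u))"
      using p by (intro tendsto_intros tendsto_powr' LIMSEQ_inverse_real_of_nat) auto
    then show ?thesis using p by (simp add: c_def[abs_def])
  qed
  have c_anti: "c n \<le> c m" if "m \<le> n" for m n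
    unfolding c_def using that p K by (intro mult_right_mono powr_mono2) (auto simp: field_simps)
  \<comment> \<open>\<open>C n\<close> contains \<open>\<alpha> U\<^sub>\<alpha> u\<close> for \<open>\<alpha> = 1 / (n + 1)\<close>. A limit of points \<open>v n \<in> C n\<close> lies in the kernel of
    \<open>I - \<beta> U\<^sub>\<beta>\<close> and differs from \<open>u\<close> by an element of the closure of its range.\<close>
  define C where "C n = {v \<in> Lp p M. Lp_modular p M (defect \<beta> v) \<le> c n \<and>
      (\<exists>w\<in>Lp p M. AE x in M. u x - v x = defect \<beta> w x)}" for n
  have mem: "(\<lambda>x. \<alpha> * U \<alpha> u x) \<in> C n" if "\<alpha> = inverse (real (Suc n))" for \<alpha> n
  proof -
    have \<alpha>: "0 < \<alpha>" using that by simp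
    have "Lp_modular p M (defect \<beta> (\<lambda>x. \<alpha> * U \<alpha> u x)) = Lp_modular p M (\<lambda>x. \<alpha> * U \<alpha> (defect \<beta> u) x)"
      using \<alpha> \<beta> u defect_scaled_resolvent[OF \<alpha> \<beta> u]
      by (intro Lp_modular_cong_AE Lp_measurable[of _ p] Lp_scale defect_in_Lp in_Lp)
    also have "\<dots> \<le> c n"
      using modular_scaled_resolvent_defect_le[OF \<alpha> \<beta> u] by (simp add: c_def K_def that)
    finally have "Lp_modular p M (defect \<beta> (\<lambda>x. \<alpha> * U \<alpha> u x)) \<le> c n" .
    \<comment> \<open>This is the preimage of \<open>u - \<alpha> U\<^sub>\<alpha> u\<close>
      supplied by \<open>defect_in_range\<close>.\<close>
    moreover have "(\<lambda>y. u y + (\<beta> - \<alpha>) * U \<alpha> u y) \<in> Lp p M"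
      using \<alpha> u by (intro Lp_add Lp_scale in_Lp p0)
    ultimately show ?thesis using defect_in_range[OF \<alpha> \<beta> u] \<alpha> u
      unfolding C_def by (blast intro: Lp_scale in_Lp)
  qed
  have mid: "(\<lambda>x. (f x + g x) / 2) \<in> C n" if f: "f \<in> C n" and g: "g \<in> C n" for f g n
  proof -
    have fg: "f \<in> Lp p M" "g \<in> Lp p M" "Lp_modular p M (defect \<beta> f) \<le> c n"
       "Lp_modular p M (defect \<beta> g) \<le> c n" using f g by (auto simp: C_def)
    obtain w1 w2 where w: "w1 \<in> Lp p M" "AE x in M. u x - f x = defect \<beta> w1 x"
      "w2 \<in> Lp p M" "AE x in M. u x - g x = defect \<beta> w2 x" using f g by (auto simp: C_def)
    have half: "AE x in M. defect \<beta> (\<lambda>x. (a x + b x) / 2) x = (defect \<beta> a x + defect \<beta> b x) / 2"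
      if "a \<in> Lp p M" "b \<in> Lp p M" for a b
      using defect_combination[OF \<beta> that, of "1/2" "1/2"] by (simp add: add_divide_distrib)
    have "Lp_modular p M (defect \<beta> (\<lambda>x. (f x + g x) / 2)) = Lp_modular p M (\<lambda>x. (defect \<beta> f x + defect \<beta> g x) / 2)"
      using half[OF fg(1,2)] \<beta> fg
      by (intro Lp_modular_cong_AE Lp_measurable[of _ p] Lp_midpoint defect_in_Lp in_Lp p0)
    also have "\<dots> \<le> (Lp_modular p M (defect \<beta> f) + Lp_modular p M (defect \<beta> g)) / 2"
      using \<beta> fg by (intro Lp_modular_midpoint_le p defect_in_Lp)
    also have "\<dots> \<le> c n" using fg by simp
    finally have "Lp_modular p M (defect \<beta> (\<lambda>x. (f x + g x) / 2)) \<le> c n" .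
    moreover have "AE x in M. u x - (f x + g x) / 2 = defect \<beta> (\<lambda>x. (w1 x + w2 x) / 2) x"
      using half[OF w(1,3)] w(2,4) by eventually_elim (simp add: field_simps)
    ultimately show ?thesis
      unfolding C_def using fg w Lp_midpoint[OF fg(1,2) p0] Lp_midpoint[OF w(1,3) p0] by blast
  qed
  have sub: "C n \<subseteq> Lp p M" for n by (auto simp: C_def)
  have anti: "C n \<subseteq> C m" if "m \<le> n" for m n using c_anti[OF that] by (auto simp: C_def)
  have bdd: "\<exists>f\<in>C n. Lp_modular p M f \<le> B * Lp_modular p M u" for n
    by (intro bexI[OF _ mem[OF refl]] bound u) simp
  obtain v g where v: "\<And>n. v n \<in> C n" and lim: "(\<lambda>n. Lp_modular p M (\<lambda>x. v n x - g x)) \<longlonglongrightarrow> 0"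
    and g: "g \<in> Lp p M"
    by (rule Lp_decreasing_midpoint_convex_Cauchy[where C = C, OF p sub anti mid bdd]) blast+
  have vLp: "v n \<in> Lp p M" for n using v sub by blast
  have dLp: "(\<lambda>x. v n x - g x) \<in> Lp p M" for n by (intro Lp_diff vLp g p0)
  \<comment> \<open>Write \<open>defect \<beta> g\<close> as \<open>defect \<beta> (v n)\<close>
    minus the defect of \<open>v n - g\<close>. The first is controlled by \<open>c n\<close>
    through membership in \<open>C n\<close>, the second by boundedness, and both bounds vanish as n
    grows.\<close>
  have "Lp_modular p M (defect \<beta> g) \<le> 2 powr p * (c n + K * Lp_modular p M (\<lambda>x. v n x - g x))" for n
  proof -
    have "AE x in M. defect \<beta> (\<lambda>y. 1 * v n y + (-1) * g y) x = 1 * defect \<beta> (v n) x + (-1) * defect \<beta> g x"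
      by (intro defect_combination \<beta> vLp g)
    then have "AE x in M. defect \<beta> g x = defect \<beta> (v n) x - defect \<beta> (\<lambda>x. v n x - g x) x"
      by eventually_elim simp
    then have "Lp_modular p M (defect \<beta> g) = Lp_modular p M (\<lambda>x. defect \<beta> (v n) x - defect \<beta> (\<lambda>x. v n x - g x) x)"
      by (intro Lp_modular_cong_AE Lp_measurable[of _ p] Lp_diff defect_in_Lp \<beta> g vLp p0)
    also have "\<dots> \<le> 2 powr p * (Lp_modular p M (defect \<beta> (v n)) + Lp_modular p M (defect \<beta> (\<lambda>x. v n x - g x)))"
      by (intro Lp_modular_diff_le defect_in_Lp \<beta> vLp dLp p0)
    also have "\<dots> \<le> 2 powr p * (c n + K * Lp_modular p M (\<lambda>x. v n x - g x))"
      using v[of n] modular_defect_le[OF \<beta> dLp]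
      by (intro mult_left_mono add_mono) (auto simp: C_def K_def)
    finally show ?thesis .
  qed
  then have le: "eventually (\<lambda>n.
      Lp_modular p M (defect \<beta> g) \<le> 2 powr p * (c n + K * Lp_modular p M (\<lambda>x. v n x - g x))) sequentially"
    by (rule always_eventually[OF allI])
  have "(\<lambda>n. 2 powr p * (c n + K * Lp_modular p M (\<lambda>x. v n x - g x))) \<longlonglongrightarrow> 2 powr p * (0 + K * 0)"
    by (intro tendsto_intros c0 lim)
  from tendsto_lowerbound[OF this le trivial_limit_sequentially]
  have "Lp_modular p M (defect \<beta> g) \<le> 2 powr p * (0 + K * 0)" .
  then have "Lp_modular p M (defect \<beta> g) = 0" by (simp add: order_antisym)
  then have ker: "AE x in M. defect \<beta> g x = 0" using Lp_modular_eq_0_iff[OF defect_in_Lp[OF \<beta> g]] by simp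
  \<comment> \<open>Split u as \<open>defect \<beta> w + (v n - g) + g\<close>. The operator
    \<open>\<alpha> U\<^sub>\<alpha>\<close> makes the first part decay with \<alpha>, is bounded on
    the second and fixes g. The choice of w depends on n but not on \<alpha>.\<close>
  have est: "\<exists>w\<in>Lp p M. \<forall>\<alpha>>0. Lp_modular p M (\<lambda>x. \<alpha> * U \<alpha> u x - g x) \<le>
     2 powr p * (\<alpha> powr p * (K * Lp_modular p M (U \<beta> w)) + B * Lp_modular p M (\<lambda>x. v n x - g x))" for n
  proof -
    obtain w where w: "w \<in> Lp p M" "AE x in M. u x - v n x = defect \<beta> w x" using v[of n] by (auto simp: C_def)
    have "Lp_modular p M (\<lambda>x. \<alpha> * U \<alpha> u x - g x) \<le>
     2 powr p * (\<alpha> powr p * (K * Lp_modular p M (U \<beta> w)) + B * Lp_modular p M (\<lambda>x. v n x - g x))"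
      if \<alpha>: "0 < \<alpha>" for \<alpha>
    proof -
      let ?h = "\<lambda>y. v n y - g y"
      have "AE x in M. U \<alpha> u x = U \<alpha> (\<lambda>y. 1 * (1 * defect \<beta> w y + 1 * ?h y) + 1 * g y) x"
        using w(2) by (intro cong_AE \<alpha> u Lp_add Lp_scale defect_in_Lp \<beta> w g dLp p0) auto
      moreover have "AE x in M. U \<alpha> (\<lambda>y. 1 * (1 * defect \<beta> w y + 1 * ?h y) + 1 * g y) x =
          1 * U \<alpha> (\<lambda>y. 1 * defect \<beta> w y + 1 * ?h y) x + 1 * U \<alpha> g x"
        by (intro combination \<alpha> Lp_add Lp_scale defect_in_Lp \<beta> w g dLp p0)
      moreover have "AE x in M. U \<alpha> (\<lambda>y. 1 * defect \<beta> w y + 1 * ?h y) x =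
          1 * U \<alpha> (defect \<beta> w) x + 1 * U \<alpha> ?h x"
        by (intro combination \<alpha> defect_in_Lp \<beta> w dLp)
      moreover have "AE x in M. \<alpha> * U \<alpha> g x = g x" by (intro fixed_point_independent[OF \<alpha> \<beta> g ker])
      ultimately have "AE x in M. \<alpha> * U \<alpha> u x - g x = \<alpha> * U \<alpha> (defect \<beta> w) x + \<alpha> * U \<alpha> ?h x"
        by eventually_elim (simp add: algebra_simps)
      then have "Lp_modular p M (\<lambda>x. \<alpha> * U \<alpha> u x - g x) =
          Lp_modular p M (\<lambda>x. \<alpha> * U \<alpha> (defect \<beta> w) x + \<alpha> * U \<alpha> ?h x)"
        by (intro Lp_modular_cong_AE Lp_measurable[of _ p] Lp_diff Lp_add Lp_scale in_Lp defect_in_Lp \<alpha> \<beta> u g w dLp p0)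
      also have "\<dots> \<le> 2 powr p * (Lp_modular p M (\<lambda>x. \<alpha> * U \<alpha> (defect \<beta> w) x) + Lp_modular p M (\<lambda>x. \<alpha> * U \<alpha> ?h x))"
        by (intro Lp_modular_add_le Lp_scale in_Lp defect_in_Lp \<alpha> \<beta> w dLp p0)
      also have "\<dots> \<le> 2 powr p * (\<alpha> powr p * (K * Lp_modular p M (U \<beta> w)) + B * Lp_modular p M ?h)"
        using modular_scaled_resolvent_defect_le[OF \<alpha> \<beta> w(1)] bound[OF \<alpha> dLp]
        by (intro mult_left_mono add_mono) (auto simp: K_def)
      finally show ?thesis .
    qed
    then show ?thesis using w(1) by blast
  qed
  have "((\<lambda>\<alpha>. Lp_modular p M (\<lambda>x. \<alpha> * U \<alpha> u x - g x)) \<longlongrightarrow> 0) (at_right 0)"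
  proof (rule order_tendstoI)
    fix e :: real assume e: "0 < e"
    \<comment> \<open>The order of choices matters: first n makes the part independent of \<alpha>
      smaller than e, then w is fixed, and only then does \<alpha> tend to 0.\<close>
    have "(\<lambda>n. 2 powr p * (B * Lp_modular p M (\<lambda>x. v n x - g x))) \<longlonglongrightarrow> 2 powr p * (B * 0)"
      by (intro tendsto_intros lim)
    from order_tendstoD(2)[OF this, of e]
    obtain n where n: "2 powr p * (B * Lp_modular p M (\<lambda>x. v n x - g x)) < e"
      using e by (auto simp: eventually_sequentially)
    obtain w where w: "\<And>\<alpha>. 0 < \<alpha> \<Longrightarrow> Lp_modular p M (\<lambda>x. \<alpha> * U \<alpha> u x - g x) \<le>
     2 powr p * (\<alpha> powr p * (K * Lp_modular p M (U \<beta> w)) + B * Lp_modular p M (\<lambda>x. v n x - g x))"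
      using est[of n] by blast
    have "((\<lambda>\<alpha>. 2 powr p * (\<alpha> powr p * (K * Lp_modular p M (U \<beta> w)) + B * Lp_modular p M (\<lambda>x. v n x - g x)))
        \<longlongrightarrow> 2 powr p * (0 powr p * (K * Lp_modular p M (U \<beta> w)) + B * Lp_modular p M (\<lambda>x. v n x - g x))) (at_right 0)"
      using p by (intro tendsto_intros tendsto_powr')
        (auto simp: eventually_at_right_less intro: eventually_at_rightI[of 0 1])
    then have "eventually (\<lambda>\<alpha>.
        2 powr p * (\<alpha> powr p * (K * Lp_modular p M (U \<beta> w)) + B * Lp_modular p M (\<lambda>x. v n x - g x)) < e) (at_right 0)"
      using n p by (intro order_tendstoD(2)) auto
    then show "eventually (\<lambda>\<alpha>. Lp_modular p M (\<lambda>x. \<alpha> * U \<alpha> u x - g x) < e) (at_right 0)"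
      using eventually_at_right_less[of 0] by eventually_elim (use w in \<open>blast intro: le_less_trans\<close>)
  qed (rule always_eventually[OF allI], erule less_le_trans, rule Lp_modular_nonneg)
  then show ?thesis using that g ker by blast
qed

lemma ergodic:
  assumes \<beta>: "0 < \<beta>" and u: "u \<in> Lp p M"
  shows "\<exists>u'\<in>Lp_kernel p M (\<lambda>f x. f x - \<beta> * U \<beta> f x).
       ((\<lambda>\<alpha>. Lp_norm p M (\<lambda>x. \<alpha> * U \<alpha> u x - u' x)) \<longlongrightarrow> 0) (at_right 0)"
proof -
  obtain v where v: "v \<in> Lp p M" "AE x in M. defect \<beta> v x = 0"
    "((\<lambda>\<alpha>. Lp_modular p M (\<lambda>x. \<alpha> * U \<alpha> u x - v x)) \<longlongrightarrow> 0) (at_right 0)"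
    using tendsto_modular[OF assms] by blast
  have "((\<lambda>\<alpha>. Lp_norm p M (\<lambda>x. \<alpha> * U \<alpha> u x - v x)) \<longlongrightarrow> 0 powr (1 / p)) (at_right 0)"
    unfolding Lp_norm_conv_modular using v(3) p by (intro tendsto_powr' tendsto_const) auto
  then show ?thesis using v(1,2) by (auto simp: Lp_kernel_def defect_def)
qed

end

theorem theorem3p1:
  fixes m :: "'a measure" and p M :: real
    and U :: "real \<Rightarrow> ('a \<Rightarrow> real) \<Rightarrow> 'a \<Rightarrow> real"
  assumes "Lusin_measurable_space m"
    and "sigma_finite_measure m"
    and "1 < p"
    and "Lp_resolvent_family p m U"
    and "0 < M"
    and "\<And>\<alpha>. 0 < \<alpha> \<Longrightarrow> Lp_onorm p m (\<lambda>f x. \<alpha> * U \<alpha> f x) \<le> M"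
  shows "Lp_ergodic p m U \<and>
    (\<forall>\<beta>>0. \<forall>u\<in>Lp p m. \<exists>u'\<in>Lp_kernel p m (\<lambda>f x. f x - \<beta> * U \<beta> f x).
       ((\<lambda>\<alpha>. Lp_norm p m (\<lambda>x. \<alpha> * U \<alpha> u x - u' x)) \<longlongrightarrow> 0) (at_right 0))"
proof -
  have p: "p \<noteq> 0" "0 \<le> p" using assms(3) by auto
  interpret Lp_bounded_resolvent p m U "M powr p"
  proof
    fix \<alpha> :: real and f assume \<alpha>: "0 < \<alpha>" and f: "f \<in> Lp p m"
    have "Lp_bounded_linear p m (U \<alpha>)"
      using assms(4) \<alpha> by (simp add: Lp_resolvent_family_def)
    then have "\<exists>C. \<forall>f\<in>Lp p m. Lp_norm p m (U \<alpha> f) \<le> C * Lp_norm p m f"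
      unfolding Lp_bounded_linear_def by (elim conjE)
    then obtain C where C: "\<And>f. f \<in> Lp p m \<Longrightarrow> Lp_norm p m (U \<alpha> f) \<le> C * Lp_norm p m f" by metis
    \<comment> \<open>This bound, which may depend on \<alpha>, serves only to make the operator
      norm a genuine bound; the uniform constant M then comes from the hypothesis on that
      norm.\<close>
    have "Lp_norm p m (\<lambda>x. \<alpha> * U \<alpha> f x) \<le> (\<alpha> * C) * Lp_norm p m f" if "f \<in> Lp p m" for f
      using C[OF that] \<alpha> p by (simp add: Lp_norm_scale)
    then have "Lp_norm p m (\<lambda>x. \<alpha> * U \<alpha> f x) \<le> Lp_onorm p m (\<lambda>f x. \<alpha> * U \<alpha> f x) * Lp_norm p m f"
      using f by (rule Lp_norm_le_onorm)
    also have "\<dots> \<le> M * Lp_norm p m f" using assms(6)[OF \<alpha>] by (intro mult_right_mono) auto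
    finally have "Lp_norm p m (\<lambda>x. \<alpha> * U \<alpha> f x) powr p \<le> (M * Lp_norm p m f) powr p"
      using p by (intro powr_mono2) auto
    then show "Lp_modular p m (\<lambda>x. \<alpha> * U \<alpha> f x) \<le> M powr p * Lp_modular p m f"
      using p by (simp add: Lp_modular_conv_norm powr_mult)
  qed (use assms in auto)
  have "Lp_ergodic p m U"
    unfolding Lp_ergodic_def
  proof
    fix u assume "u \<in> Lp p m"
    \<comment> \<open>Ergodicity does not mention \<beta>, so the value 1 is an arbitrary
      choice.\<close>
    from ergodic[OF zero_less_one this]
    show "\<exists>u'\<in>Lp p m. ((\<lambda>\<alpha>. Lp_norm p m (\<lambda>x. \<alpha> * U \<alpha> u x - u' x)) \<longlongrightarrow> 0) (at_right 0)"
      unfolding Lp_kernel_def by blast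
  qed
  then show ?thesis using ergodic by blast
qed

end
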